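(* Let $n\ge1$, $m\ge0$ with $D=2n+m\ge3$, let $\Gamma=(X,\mathcal{R})$ be the Doob graph $D(n,m)$, and fix $x\in X$. Then $$-\tfrac12RL^2+LRL-\tfrac12L^2R=3L$$ holds on $E_i^*V$ for every $1\le i\le D$. In particular, $\Gamma$ supports a strongly uniform structure with respect to $x$, with $e_i^-=-\frac12$ ($2\le i\le D$), $e_i^+=-\frac12$ ($1\le i\le D-1$), and $f_i=3$ ($1\le i\le D$).
   Context: Doob graph $D(n,m)$: the Cartesian product of $n$ copies of the Shrikhande graph (the Cayley graph on $\mathbb{Z}_4\times\mathbb{Z}_4$ with connection set $\{\pm(1,0),\pm(0,1),\pm(1,1)\}$) and $m$ copies of $K_4$; its diameter is $2n+m$. With distance $\partial$: $V=\mathbb{C}^X$, $A$ the adjacency matrix, $E_i^*$ the diagonal $0/1$ matrix with $(y,y)$-entry $1$ iff $\partial(x,y)=i$; $L=\sum_{i=1}^{D}E^*_{i-1}AE^*_i$, $R=\sum_{i=0}^{D-1}E^*_{i+1}AE^*_i=L^\top$. $\Gamma_f$ is the graph on $X$ whose edges are the edges $yz$ of $\Gamma$ with $\partial(x,y)\ne\partial(x,z)$ (bipartite with lowering/raising matrices $L,R$). A parameter matrix is a tridiagonal complex $U=(e_{ij})_{1\le i,j\le D}$ with $e_{ii}=1$, with $e_{i,i-1}\ne0$ for all $2\le i\le D$ or $e_{i-1,i}\ne0$ for all $2\le i\le D$, and every principal submatrix $(e_{ij})_{s\le i,j\le t}$ nonsingular; $e_i^-=e_{i,i-1}$, $e_i^+=e_{i,i+1}$,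 $e_1^-=e_D^+=0$. A uniform structure of $\Gamma_f$ w.r.t. $x$ is a pair $(U,f)$, $f\in\mathbb{C}^D$, with $e_i^-RL^2+LRL+e_i^+L^2R=f_iL$ on $E_i^*V$ for all $1\le i\le D$; strongly uniform if all $e_i^-$ ($2\le i\le D$) and $e_i^+$ ($1\le i\le D-1$) are nonzero. $\Gamma$ supports a strongly uniform structure w.r.t. $x$ if $\Gamma_f$ admits one. *)

theory Defs
  imports
    Complex_Main
    "HOL-Library.FuncSet"
    "HOL-Library.Numeral_Type"
    "HOL-Library.Product_Plus"
    "Jordan_Normal_Form.Determinant"
    "Jordan_Normal_Form.DL_Submatrix"
begin

section \<open>Graphs\<close>

record 'v graph =
  verts :: "'v set"
  adj :: "'v \<Rightarrow> 'v \<Rightarrow> bool"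

text \<open>Only used for connected graphs: the number is unspecified if there is no path.\<close>

definition gdist :: "'v graph \<Rightarrow> 'v \<Rightarrow> 'v \<Rightarrow> nat" where
  "gdist G y z = (LEAST k. (adj G ^^ k) y z)"

definition diameter :: "'v graph \<Rightarrow> nat" where
  "diameter G = Max {gdist G y z | y z. y \<in> verts G \<and> z \<in> verts G}"

definition cayley_graph :: "'g::ab_group_add set \<Rightarrow> 'g graph" where
  "cayley_graph S = \<lparr>verts = UNIV, adj = (\<lambda>y z. z - y \<in> S)\<rparr>"

text \<open>The type \<open>4\<close> is the ring of integers modulo 4.\<close>

definition shrikhande :: "(4 \<times> 4) graph" where
  "shrikhande = cayley_graph {(1, 0), - (1, 0), (0, 1), - (0, 1), (1, 1), - (1, 1)}"

definition K4 :: "4 graph" where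
  "K4 = \<lparr>verts = UNIV, adj = (\<lambda>y z. y \<noteq> z)\<rparr>"

definition cart_prod :: "'v graph \<Rightarrow> 'w graph \<Rightarrow> ('v \<times> 'w) graph" where
  "cart_prod G H =
    \<lparr>verts = verts G \<times> verts H,
     adj = (\<lambda>(y, y') (z, z').
       y \<in> verts G \<and> z \<in> verts G \<and> y' \<in> verts H \<and> z' \<in> verts H \<and>
       (adj G y z \<and> y' = z' \<or> y = z \<and> adj H y' z'))\<rparr>"

text \<open>For \<open>n = 0\<close> this is the graph with one vertex.\<close>

definition cart_power :: "nat \<Rightarrow> 'v graph \<Rightarrow> (nat \<Rightarrow> 'v) graph" where
  "cart_power n G =
    \<lparr>verts = {..<n} \<rightarrow>\<^sub>E verts G,
     adj = (\<lambda>y z.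
       y \<in> {..<n} \<rightarrow>\<^sub>E verts G \<and> z \<in> {..<n} \<rightarrow>\<^sub>E verts G \<and>
       (\<exists>k<n. adj G (y k) (z k) \<and> (\<forall>j<n. j \<noteq> k \<longrightarrow> y j = z j)))\<rparr>"

definition doob :: "nat \<Rightarrow> nat \<Rightarrow> ((nat \<Rightarrow> 4 \<times> 4) \<times> (nat \<Rightarrow> 4)) graph" where
  "doob n m = cart_prod (cart_power n shrikhande) (cart_power m K4)"

text \<open>The bipartite graph \<open>\<Gamma>\<^sub>f\<close>: drop the edges inside the spheres around \<open>x\<close>.\<close>

definition gamma_f :: "'v graph \<Rightarrow> 'v \<Rightarrow> 'v graph" where
  "gamma_f G x =
    \<lparr>verts = verts G, adj = (\<lambda>y z. adj G y z \<and> gdist G x y \<noteq> gdist G x z)\<rparr>"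

section \<open>Matrices indexed by the vertex set\<close>

text \<open>
  A matrix with rows and columns indexed by the vertex set \<open>X\<close> is a function on pairs of
  vertices that vanishes outside \<open>X \<times> X\<close>; a vector of \<open>V = \<complex>\<^sup>X\<close> is a function that vanishes
  outside \<open>X\<close>.
\<close>

type_synonym 'v vmat = "'v \<Rightarrow> 'v \<Rightarrow> complex"

definition mmul :: "'v graph \<Rightarrow> 'v vmat \<Rightarrow> 'v vmat \<Rightarrow> 'v vmat" where
  "mmul G M N = (\<lambda>y z. \<Sum>w\<in>verts G. M y w * N w z)"

definition mvec :: "'v graph \<Rightarrow> 'v vmat \<Rightarrow> ('v \<Rightarrow> complex) \<Rightarrow> 'v \<Rightarrow> complex" where
  "mvec G M v = (\<lambda>y. \<Sum>z\<in>verts G. M y z * v z)"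

definition standard_module :: "'v graph \<Rightarrow> ('v \<Rightarrow> complex) set" where
  "standard_module G = {v. \<forall>y. y \<notin> verts G \<longrightarrow> v y = 0}"

definition adj_mat :: "'v graph \<Rightarrow> 'v vmat" where
  "adj_mat G = (\<lambda>y z. if y \<in> verts G \<and> z \<in> verts G \<and> adj G y z then 1 else 0)"

definition dual_idem :: "'v graph \<Rightarrow> 'v \<Rightarrow> nat \<Rightarrow> 'v vmat" where
  "dual_idem G x i = (\<lambda>y z. if y = z \<and> y \<in> verts G \<and> gdist G x y = i then 1 else 0)"

definition subconstituent :: "'v graph \<Rightarrow> 'v \<Rightarrow> nat \<Rightarrow> ('v \<Rightarrow> complex) set" where
  "subconstituent G x i = mvec G (dual_idem G x i) ` standard_module G"

definition lowering :: "'v graph \<Rightarrow> 'v \<Rightarrow> nat \<Rightarrow> 'v vmat" where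
  "lowering G x D = (\<lambda>y z. \<Sum>i = 1..D.
     mmul G (dual_idem G x (i - 1)) (mmul G (adj_mat G) (dual_idem G x i)) y z)"

definition raising :: "'v graph \<Rightarrow> 'v \<Rightarrow> nat \<Rightarrow> 'v vmat" where
  "raising G x D = (\<lambda>y z. \<Sum>i<D.
     mmul G (dual_idem G x (i + 1)) (mmul G (adj_mat G) (dual_idem G x i)) y z)"

section \<open>Uniform structures\<close>

text \<open>Library matrices and vectors are indexed from 0, parameter matrices from 1.\<close>

definition entry :: "complex mat \<Rightarrow> nat \<Rightarrow> nat \<Rightarrow> complex" where
  "entry U i j = U $$ (i - 1, j - 1)"

definition coord :: "complex vec \<Rightarrow> nat \<Rightarrow> complex" where
  "coord f i = f $ (i - 1)"

definition e_minus :: "complex mat \<Rightarrow> nat \<Rightarrow> complex" where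
  "e_minus U i = (if i = 1 then 0 else entry U i (i - 1))"

definition e_plus :: "complex mat \<Rightarrow> nat \<Rightarrow> complex" where
  "e_plus U i = (if i = dim_row U then 0 else entry U i (i + 1))"

definition parameter_matrix :: "nat \<Rightarrow> complex mat \<Rightarrow> bool" where
  "parameter_matrix D U \<longleftrightarrow>
     U \<in> carrier_mat D D \<and>
     (\<forall>i\<in>{1..D}. \<forall>j\<in>{1..D}. i + 1 < j \<or> j + 1 < i \<longrightarrow> entry U i j = 0) \<and>
     (\<forall>i\<in>{1..D}. entry U i i = 1) \<and>
     ((\<forall>i\<in>{2..D}. entry U i (i - 1) \<noteq> 0) \<or> (\<forall>i\<in>{2..D}. entry U (i - 1) i \<noteq> 0)) \<and>
     (\<forall>s t. 1 \<le> s \<and> s \<le> t \<and> t \<le> D \<longrightarrow> det (submatrix U {s - 1..t - 1} {s - 1..t - 1}) \<noteq> 0)"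

text \<open>
  \<open>H\<close> is bipartite (in the application \<open>H = \<Gamma>\<^sub>f\<close>). Distances from \<open>x\<close> in \<open>\<Gamma>\<^sub>f\<close> and in \<open>\<Gamma>\<close>
  coincide, so the lowering and raising matrices of \<open>\<Gamma>\<^sub>f\<close> are those of \<open>\<Gamma>\<close>. The diameters of
  the two graphs may differ, hence the separate parameter \<open>D\<close>.
\<close>

definition uniform_structure ::
    "'v graph \<Rightarrow> 'v \<Rightarrow> nat \<Rightarrow> complex mat \<Rightarrow> complex vec \<Rightarrow> bool" where
  "uniform_structure H x D U f \<longleftrightarrow>
     parameter_matrix D U \<and> f \<in> carrier_vec D \<and>
     (let L = lowering H x D; R = raising H x D in
       \<forall>i\<in>{1..D}. \<forall>v\<in>subconstituent H x i. \<forall>y\<in>verts H.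
         e_minus U i * mvec H (mmul H R (mmul H L L)) v y
           + mvec H (mmul H L (mmul H R L)) v y
           + e_plus U i * mvec H (mmul H L (mmul H L R)) v y
         = coord f i * mvec H L v y)"

definition strongly_uniform_structure ::
    "'v graph \<Rightarrow> 'v \<Rightarrow> nat \<Rightarrow> complex mat \<Rightarrow> complex vec \<Rightarrow> bool" where
  "strongly_uniform_structure H x D U f \<longleftrightarrow>
     uniform_structure H x D U f \<and>
     (\<forall>i\<in>{2..D}. e_minus U i \<noteq> 0) \<and> (\<forall>i\<in>{1..D - 1}. e_plus U i \<noteq> 0)"

definition supports_strongly_uniform :: "'v graph \<Rightarrow> 'v \<Rightarrow> bool" where
  "supports_strongly_uniform G x \<longleftrightarrow>
     (\<exists>U f. strongly_uniform_structure (gamma_f G x) x (diameter G) U f)"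

end

(*
  The identity says that the double commutator [L, [L, R]] equals -6 L.  Distances in a Cartesian
  product are sums of distances in the factors, so L and R are sums of lowering and raising
  operators acting on single coordinates.  Operators on different coordinates commute, hence
  all mixed terms of the double commutator vanish, and it suffices to check the identity in the
  Shrikhande graph and in K4; by translation the base vertex may be taken to be 0.
  The conditions e_1^- = e_D^+ = 0 do no harm because L^2 vanishes on E_1^* V and R on E_D^* V.
*)
theory Submission
  imports Defs
begin

section \<open>Level sums\<close>

text \<open>Up to scaling this is a relation of sl2: with \<open>H = [L, R]\<close> it reads
  \<open>[H, L] = 6 L\<close>. A sum of commuting copies inherits it provided that all copies share
  the constant. They do, because between its levels the Shrikhande graph looks like the product of
  two copies of K4: the six neighbours of the base vertex split into two triples, and the nine
  vertices at distance two correspond to the nine pairs with one member from each triple. Hence the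
  constant 3 does not depend on n and m.

  The vertices of the Doob graph are extensional functions, and membership conditions would burden
  every commutation argument. The coordinate operators therefore act on all functions on the ambient
  type, where overwriting a coordinate is always allowed. They agree with the true L and R at
  vertices, and since a neighbour of a vertex is a vertex, this suffices for threefold
  products.\<close>

definition level_sum ::
    "(nat \<Rightarrow> nat \<Rightarrow> bool) \<Rightarrow> ('a \<Rightarrow> 'a \<Rightarrow> bool) \<Rightarrow> ('a \<Rightarrow> nat) \<Rightarrow> ('a \<Rightarrow> complex) \<Rightarrow> 'a \<Rightarrow> complex" where
  "level_sum P E r f a = (\<Sum>b | E a b \<and> P (r a) (r b). f b)"

text \<open>Both predicates depend only on the difference of the two levels. In a product the other
  coordinates add the same amount to both levels, so this invariance lets one lemma about
  \<open>level_sum\<close> serve lowering and raising alike.\<close>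

abbreviation (input) up :: "nat \<Rightarrow> nat \<Rightarrow> bool" where "up i j \<equiv> j = Suc i"
abbreviation (input) down :: "nat \<Rightarrow> nat \<Rightarrow> bool" where "down i j \<equiv> i = Suc j"

text \<open>The lowering matrix sums over upper neighbours, hence the apparent swap.\<close>

abbreviation "lower_op \<equiv> level_sum up"
abbreviation "raise_op \<equiv> level_sum down"

text \<open>The expanded double commutator, which is the desired relation multiplied by -2 to clear
  the fractions.\<close>

definition uniform_pair ::
    "(('a \<Rightarrow> complex) \<Rightarrow> 'a \<Rightarrow> complex) \<Rightarrow> (('a \<Rightarrow> complex) \<Rightarrow> 'a \<Rightarrow> complex) \<Rightarrow> bool" where
  "uniform_pair L R \<longleftrightarrow>
     (\<forall>f y. L (L (R f)) y - 2 * L (R (L f)) y + R (L (L f)) y = - 6 * L f y)"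

lemma level_sum_sum:
  "level_sum P E r (\<lambda>y. \<Sum>j\<in>J. F j y) = (\<lambda>y. \<Sum>j\<in>J. level_sum P E r (F j) y)"
  unfolding level_sum_def by (rule ext) (rule sum.swap)

lemma level_sum_cong:
  assumes "\<And>b. E a b \<Longrightarrow> f b = g b"
  shows "level_sum P E r f a = level_sum P E r g a"
  unfolding level_sum_def by (intro sum.cong) (auto simp: assms)

lemma level_sum_UNIV:
  "level_sum P E r f a = (\<Sum>b\<in>UNIV. if E a b \<and> P (r a) (r b) then f b else 0)"
  for a :: "'a::finite"
  unfolding level_sum_def by (simp add: sum.If_cases)

lemma level_sum_translate:
  fixes S :: "'a::ab_group_add set"
  shows "level_sum P (\<lambda>a b. b - a \<in> S) (\<lambda>b. r (b - c)) f a =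
    level_sum P (\<lambda>a b. b - a \<in> S) r (\<lambda>b. f (b + c)) (a - c)"
  unfolding level_sum_def
  by (rule sum.reindex_bij_witness[where i = "\<lambda>b. b + c" and j = "\<lambda>b. b - c"])
     (auto simp: algebra_simps)

lemma uniform_pair_translate:
  fixes S :: "'a::ab_group_add set"
  assumes "uniform_pair (lower_op (\<lambda>a b. b - a \<in> S) r) (raise_op (\<lambda>a b. b - a \<in> S) r)"
  shows "uniform_pair (lower_op (\<lambda>a b. b - a \<in> S) (\<lambda>b. r (b - c)))
    (raise_op (\<lambda>a b. b - a \<in> S) (\<lambda>b. r (b - c)))"
  using assms unfolding uniform_pair_def by (simp add: level_sum_translate)

text \<open>The double commutator is additive in each of its three arguments, so it expands into
  triples \<open>[L i, [L j, R k]]\<close>. Commutation between different indices removes all but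
  the diagonal ones.\<close>

lemma uniform_pair_sum:
  fixes L R :: "'i \<Rightarrow> ('a \<Rightarrow> complex) \<Rightarrow> 'a \<Rightarrow> complex"
  assumes fin: "finite I"
    and sumL: "\<And>i (F :: 'i \<Rightarrow> 'a \<Rightarrow> complex).
      i \<in> I \<Longrightarrow> L i (\<lambda>y. \<Sum>j\<in>I. F j y) = (\<lambda>y. \<Sum>j\<in>I. L i (F j) y)"
    and sumR: "\<And>i (F :: 'i \<Rightarrow> 'a \<Rightarrow> complex).
      i \<in> I \<Longrightarrow> R i (\<lambda>y. \<Sum>j\<in>I. F j y) = (\<lambda>y. \<Sum>j\<in>I. R i (F j) y)"
    and LL: "\<And>i j f. i \<in> I \<Longrightarrow> j \<in> I \<Longrightarrow> i \<noteq> j \<Longrightarrow> L i (L j f) = L j (L i f)"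
    and LR: "\<And>i j f. i \<in> I \<Longrightarrow> j \<in> I \<Longrightarrow> i \<noteq> j \<Longrightarrow> L i (R j f) = R j (L i f)"
    and pair: "\<And>i. i \<in> I \<Longrightarrow> uniform_pair (L i) (R i)"
  shows "uniform_pair (\<lambda>f y. \<Sum>i\<in>I. L i f y) (\<lambda>f y. \<Sum>i\<in>I. R i f y)"
  unfolding uniform_pair_def
proof (intro allI)
  fix f :: "'a \<Rightarrow> complex" and y
  let ?L = "\<lambda>f y. \<Sum>i\<in>I. L i f y" and ?R = "\<lambda>f y. \<Sum>i\<in>I. R i f y"
  have LLR: "?L (?L (?R f)) y = (\<Sum>i\<in>I. \<Sum>j\<in>I. \<Sum>k\<in>I. L i (L j (R k f)) y)"
    by (simp add: sumL sumR)
  have "?L (?R (?L f)) y = (\<Sum>i\<in>I. \<Sum>k\<in>I. \<Sum>j\<in>I. L i (R k (L j f)) y)"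
    by (simp add: sumL sumR)
  then have LRL: "?L (?R (?L f)) y = (\<Sum>i\<in>I. \<Sum>j\<in>I. \<Sum>k\<in>I. L i (R k (L j f)) y)"
    by (simp add: sum.swap[of "\<lambda>k j. L _ (R k (L j f)) y"])
  \<comment> \<open>The term \<open>L R L\<close> occurs twice. The two copies get different index
    names because \<open>[L i, [L j, R k]]\<close> contains both \<open>L i R k L j\<close> and
    \<open>L j R k L i\<close>.\<close>
  then have LRL': "?L (?R (?L f)) y = (\<Sum>i\<in>I. \<Sum>j\<in>I. \<Sum>k\<in>I. L j (R k (L i f)) y)"
    using sum.swap[of "\<lambda>i j. \<Sum>k\<in>I. L j (R k (L i f)) y" I I] by simp
  have "?R (?L (?L f)) y = (\<Sum>k\<in>I. \<Sum>i\<in>I. \<Sum>j\<in>I. R k (L i (L j f)) y)"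
    by (simp add: sumL sumR)
  also have "\<dots> = (\<Sum>i\<in>I. \<Sum>k\<in>I. \<Sum>j\<in>I. R k (L i (L j f)) y)"
    by (rule sum.swap)
  also have "\<dots> = (\<Sum>i\<in>I. \<Sum>j\<in>I. \<Sum>k\<in>I. R k (L i (L j f)) y)"
    by (rule sum.cong[OF refl]) (rule sum.swap)
  finally have RLL: "?R (?L (?L f)) y = \<dots>" .
  \<comment> \<open>For \<open>k \<noteq> j\<close> the inner commutator vanishes; for
    \<open>k = j \<noteq> i\<close> the operator \<open>L i\<close> commutes with both of its
    members. The nested conditionals on the right have the shape in which the sums over
    \<open>k\<close> and \<open>j\<close> collapse.\<close>
  have triple: "L i (L j (R k f)) y - L i (R k (L j f)) y - L j (R k (L i f)) y + R k (L i (L j f)) y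
      = (if k = j then if j = i then - 6 * L i f y else 0 else 0)"
    if "i \<in> I" "j \<in> I" "k \<in> I" for i j k
  proof (cases "k = j")
    case True
    show ?thesis
    proof (cases "i = j")
      case True
      have "L i (L i (R i f)) y - 2 * L i (R i (L i f)) y + R i (L i (L i f)) y = - 6 * L i f y"
        using pair[OF \<open>i \<in> I\<close>] by (simp add: uniform_pair_def)
      with True \<open>k = j\<close> show ?thesis by simp
    next
      case False
      have "L j (R j (L i f)) = L i (L j (R j f))"
        using that False by (metis LL LR)
      moreover have "R j (L i (L j f)) = L i (R j (L j f))"
        using that False by (metis LR)
      ultimately show ?thesis
        using False \<open>k = j\<close> by simp
    qed
  next
    case False
    have "L j (R k g) = R k (L j g)" for g
      using that False LR by metis
    moreover have "L i (L j f) = L j (L i f)"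
      using that LL by (cases "i = j") auto
    ultimately show ?thesis
      using False by simp
  qed
  have "?L (?L (?R f)) y - 2 * ?L (?R (?L f)) y + ?R (?L (?L f)) y
      = ?L (?L (?R f)) y - ?L (?R (?L f)) y - ?L (?R (?L f)) y + ?R (?L (?L f)) y"
    by simp
  also have "\<dots> = (\<Sum>i\<in>I. \<Sum>j\<in>I. \<Sum>k\<in>I. L i (L j (R k f)) y - L i (R k (L j f)) y
      - L j (R k (L i f)) y + R k (L i (L j f)) y)"
    unfolding LLR RLL by (subst LRL, subst LRL') (simp only: sum.distrib sum_subtractf)
  also have "\<dots> = (\<Sum>i\<in>I. \<Sum>j\<in>I. \<Sum>k\<in>I. if k = j then if j = i then - 6 * L i f y else 0 else 0)"
    by (intro sum.cong refl triple)
  also have "\<dots> = - 6 * ?L f y"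
    using fin by (simp add: sum_distrib_left sum_negf)
  finally show "?L (?L (?R f)) y - 2 * ?L (?R (?L f)) y + ?R (?L (?L f)) y = - 6 * ?L f y" .
qed

section \<open>The Shrikhande graph and the complete graph\<close>

lemma UNIV_4: "(UNIV :: 4 set) = {0, 1, 2, 3}"
  by (rule sym, rule card_seteq) auto

lemma all_4: "(\<forall>a::4. P a) \<longleftrightarrow> P 0 \<and> P 1 \<and> P 2 \<and> P 3"
  using UNIV_4 by (metis (full_types) UNIV_I insertE singletonD)

lemma sum_4_4:
  "(\<Sum>b\<in>UNIV. g b) = (\<Sum>i\<in>{0, 1, 2, 3::4}. \<Sum>j\<in>{0, 1, 2, 3::4}. g (i, j))"
  by (simp only: UNIV_4[symmetric] sum.cartesian_product UNIV_Times_UNIV) simp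

definition shrikhande_conn :: "(4 \<times> 4) set" where
  "shrikhande_conn = {(1, 0), - (1, 0), (0, 1), - (0, 1), (1, 1), - (1, 1)}"

lemma mem_shrikhande_conn:
  "(i, j) \<in> shrikhande_conn \<longleftrightarrow>
    (i, j) \<in> {(1, 0), (3, 0), (0, 1), (0, 3), (1, 1), (3, 3)}"
proof -
  have "- (1 :: 4) = 3" by simp
  then show ?thesis by (simp only: shrikhande_conn_def uminus_Pair minus_zero)
qed

text \<open>This is the distance from 0, as \<open>rank_from_shrikhande\<close> confirms; the value
  2 is the diameter.\<close>

definition shrikhande_rank :: "4 \<times> 4 \<Rightarrow> nat" where
  "shrikhande_rank a = (if a = 0 then 0 else if a \<in> shrikhande_conn then 1 else 2)"

definition K4_rank :: "4 \<Rightarrow> nat" where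
  "K4_rank a = (if a = 0 then 0 else 1)"

lemma adj_shrikhande: "adj shrikhande = (\<lambda>a b. b - a \<in> shrikhande_conn)"
  by (simp add: shrikhande_def cayley_graph_def shrikhande_conn_def)

text \<open>Presents K4 as a Cayley graph of the integers modulo 4, so that the translation lemma
  covers both kinds of factor.\<close>

lemma adj_K4: "adj K4 = (\<lambda>a b. b - a \<in> - {0})"
  by (auto simp: K4_def fun_eq_iff)

text \<open>A complete table, which turns the commutator identity into sixteen linear identities in
  the values of \<open>f\<close>. The graph is strongly regular with parameters (16, 6, 2, 2): each
  neighbour of 0 has 6 - 1 - 2 = 3 upper neighbours, and in the companion table each vertex at
  distance two has 2 lower neighbours.\<close>

lemma lower_shrikhande:
  fixes f
  defines "L \<equiv> lower_op (\<lambda>a b. b - a \<in> shrikhande_conn) shrikhande_rank f"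
  shows "L (0, 0) = f (0, 1) + f (0, 3) + f (1, 0) + f (1, 1) + f (3, 0) + f (3, 3)"
    and "L (0, 1) = f (0, 2) + f (1, 2) + f (3, 1)"
    and "L (0, 2) = 0"
    and "L (0, 3) = f (0, 2) + f (1, 3) + f (3, 2)"
    and "L (1, 0) = f (1, 3) + f (2, 0) + f (2, 1)"
    and "L (1, 1) = f (1, 2) + f (2, 1) + f (2, 2)"
    and "L (1, 2) = 0"
    and "L (1, 3) = 0"
    and "L (2, 0) = 0"
    and "L (2, 1) = 0"
    and "L (2, 2) = 0"
    and "L (2, 3) = 0"
    and "L (3, 0) = f (2, 0) + f (2, 3) + f (3, 1)"
    and "L (3, 1) = 0"
    and "L (3, 2) = 0"
    and "L (3, 3) = f (2, 2) + f (2, 3) + f (3, 2)"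
  unfolding L_def level_sum_UNIV sum_4_4
  by (simp_all add: mem_shrikhande_conn shrikhande_rank_def zero_prod_def)

lemma raise_shrikhande:
  fixes f
  defines "R \<equiv> raise_op (\<lambda>a b. b - a \<in> shrikhande_conn) shrikhande_rank f"
  shows "R (0, 0) = 0"
    and "R (0, 1) = f (0, 0)"
    and "R (0, 2) = f (0, 1) + f (0, 3)"
    and "R (0, 3) = f (0, 0)"
    and "R (1, 0) = f (0, 0)"
    and "R (1, 1) = f (0, 0)"
    and "R (1, 2) = f (0, 1) + f (1, 1)"
    and "R (1, 3) = f (0, 3) + f (1, 0)"
    and "R (2, 0) = f (1, 0) + f (3, 0)"
    and "R (2, 1) = f (1, 0) + f (1, 1)"
    and "R (2, 2) = f (1, 1) + f (3, 3)"
    and "R (2, 3) = f (3, 0) + f (3, 3)"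
    and "R (3, 0) = f (0, 0)"
    and "R (3, 1) = f (0, 1) + f (3, 0)"
    and "R (3, 2) = f (0, 3) + f (3, 3)"
    and "R (3, 3) = f (0, 0)"
  unfolding R_def level_sum_UNIV sum_4_4
  by (simp_all add: mem_shrikhande_conn shrikhande_rank_def zero_prod_def)

text \<open>At the base vertex the contributions are 6 - 12 = -6 times \<open>L f\<close>. At a
  neighbour \<open>v\<close> of it \<open>L L R\<close> vanishes, and \<open>L R L\<close> gives
  three times \<open>L f v\<close> plus the sum of \<open>L f\<close> over the triple not containing
  \<open>v\<close>. The upper neighbours of either triple cover the nine outer vertices once, so
  twice that sum equals the term \<open>R L L\<close> and cancels it.\<close>

lemma uniform_pair_shrikhande:
  "uniform_pair (lower_op (adj shrikhande) (\<lambda>b. shrikhande_rank (b - c)))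
    (raise_op (adj shrikhande) (\<lambda>b. shrikhande_rank (b - c)))"
  unfolding adj_shrikhande
proof (rule uniform_pair_translate)
  show "uniform_pair (lower_op (\<lambda>a b. b - a \<in> shrikhande_conn) shrikhande_rank)
    (raise_op (\<lambda>a b. b - a \<in> shrikhande_conn) shrikhande_rank)"
    unfolding uniform_pair_def split_paired_All all_4
    by (simp add: lower_shrikhande raise_shrikhande algebra_simps)
qed

lemma lower_K4:
  fixes f
  defines "L \<equiv> lower_op (\<lambda>a b. b - a \<in> - {0}) K4_rank f"
  shows "L 0 = f 1 + f 2 + f 3" and "L 1 = 0" and "L 2 = 0" and "L 3 = 0"
  unfolding L_def level_sum_UNIV UNIV_4 by (simp_all add: K4_rank_def)

lemma raise_K4:
  fixes f
  defines "R \<equiv> raise_op (\<lambda>a b. b - a \<in> - {0}) K4_rank f"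
  shows "R 0 = 0" and "R 1 = f 0" and "R 2 = f 0" and "R 3 = f 0"
  unfolding R_def level_sum_UNIV UNIV_4 by (simp_all add: K4_rank_def)

lemma uniform_pair_K4:
  "uniform_pair (lower_op (adj K4) (\<lambda>b. K4_rank (b - c)))
    (raise_op (adj K4) (\<lambda>b. K4_rank (b - c)))"
  unfolding adj_K4
proof (rule uniform_pair_translate)
  show "uniform_pair (lower_op (\<lambda>a b. b - a \<in> - {0}) K4_rank)
    (raise_op (\<lambda>a b. b - a \<in> - {0}) K4_rank)"
    unfolding uniform_pair_def all_4 lower_K4 raise_K4 by simp
qed

section \<open>Operators acting on one coordinate\<close>

text \<open>The getter \<open>g\<close> and the setter \<open>u\<close> describe one coordinate of a
  product; \<open>T\<close> is applied to the restriction of \<open>f\<close> to the line through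
  \<open>y\<close> in that direction.\<close>

definition lift ::
    "('p \<Rightarrow> 'a) \<Rightarrow> ('a \<Rightarrow> 'p \<Rightarrow> 'p) \<Rightarrow> (('a \<Rightarrow> complex) \<Rightarrow> 'a \<Rightarrow> complex) \<Rightarrow>
      ('p \<Rightarrow> complex) \<Rightarrow> 'p \<Rightarrow> complex" where
  "lift g u T f y = T (\<lambda>b. f (u b y)) (g y)"

lemma lift_level_sum_sum:
  "lift g u (level_sum P E r) (\<lambda>y. \<Sum>j\<in>J. F j y) =
    (\<lambda>y. \<Sum>j\<in>J. lift g u (level_sum P E r) (F j) y)"
  by (rule ext) (simp add: lift_def level_sum_sum)

text \<open>By the three getter-setter laws, repeated lifts stay on one line and restrict there to
  the iterated operators, so the identity is inherited line by line.\<close>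

lemma uniform_pair_lift:
  assumes "\<And>b y. g (u b y) = b" and "\<And>b c y. u c (u b y) = u c y"
    and "\<And>y. u (g y) y = y"
    and "uniform_pair L R"
  shows "uniform_pair (lift g u L) (lift g u R)"
  using assms unfolding uniform_pair_def lift_def by simp

text \<open>Overwriting one coordinate changes neither the neighbours nor the levels in the other,
  so both sides are the same double sum in different order.\<close>

lemma lift_commute:
  assumes "\<And>b y. g (u' b y) = g y" and "\<And>b y. g' (u b y) = g' y"
    and "\<And>b c y. u c (u' b y) = u' b (u c y)"
  shows "lift g u (level_sum P E r) (lift g' u' (level_sum Q F s) f) =
    lift g' u' (level_sum Q F s) (lift g u (level_sum P E r) f)"
  unfolding lift_def level_sum_def assms by (rule ext) (rule sum.swap)

text \<open>The index type \<open>nat + nat\<close> gathers the Shrikhande and the K4 coordinates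
  into a single family, so that \<open>uniform_pair_sum\<close> applies to all of them at
  once.\<close>

definition coord_op ::
    "(nat \<Rightarrow> nat \<Rightarrow> bool) \<Rightarrow> (nat \<Rightarrow> 4 \<times> 4) \<times> (nat \<Rightarrow> 4) \<Rightarrow> nat + nat \<Rightarrow>
      ((nat \<Rightarrow> 4 \<times> 4) \<times> (nat \<Rightarrow> 4) \<Rightarrow> complex) \<Rightarrow> (nat \<Rightarrow> 4 \<times> 4) \<times> (nat \<Rightarrow> 4) \<Rightarrow> complex" where
  "coord_op P x i = (case i of
     Inl k \<Rightarrow> lift (\<lambda>y. fst y k) (\<lambda>b y. ((fst y)(k := b), snd y))
       (level_sum P (adj shrikhande) (\<lambda>b. shrikhande_rank (b - fst x k)))
   | Inr k \<Rightarrow> lift (\<lambda>y. snd y k) (\<lambda>b y. (fst y, (snd y)(k := b)))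
       (level_sum P (adj K4) (\<lambda>b. K4_rank (b - snd x k))))"

lemma coord_op_sum:
  "coord_op P x i (\<lambda>y. \<Sum>j\<in>J. F j y) = (\<lambda>y. \<Sum>j\<in>J. coord_op P x i (F j) y)"
  by (cases i) (simp_all add: coord_op_def lift_level_sum_sum)

lemma coord_op_commute:
  assumes "i \<noteq> j"
  shows "coord_op P x i (coord_op Q x j f) = coord_op Q x j (coord_op P x i f)"
  using assms
  by (cases i; cases j)
     (auto simp: coord_op_def fun_upd_twist intro!: lift_commute)

lemma uniform_pair_coord_op: "uniform_pair (coord_op up x i) (coord_op down x i)"
  by (cases i)
     (auto simp: coord_op_def
       intro!: uniform_pair_lift uniform_pair_shrikhande uniform_pair_K4)

definition doob_op where
  "doob_op P n m x f y = (\<Sum>i\<in>{..<n} <+> {..<m}. coord_op P x i f y)"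

lemma uniform_pair_doob_op: "uniform_pair (doob_op up n m x) (doob_op down n m x)"
proof -
  have "uniform_pair (\<lambda>f y. \<Sum>i\<in>{..<n} <+> {..<m}. coord_op up x i f y)
      (\<lambda>f y. \<Sum>i\<in>{..<n} <+> {..<m}. coord_op down x i f y)"
    by (rule uniform_pair_sum)
       (simp_all add: coord_op_sum coord_op_commute uniform_pair_coord_op)
  then show ?thesis
    by (simp add: doob_op_def[abs_def])
qed

section \<open>Distances in product graphs\<close>

definition simple_graph :: "'v graph \<Rightarrow> bool" where
  "simple_graph G \<longleftrightarrow> finite (verts G) \<and>
     (\<forall>y z. adj G y z \<longrightarrow> y \<in> verts G \<and> z \<in> verts G \<and> y \<noteq> z)"

text \<open>A local certificate that \<open>r\<close> is the distance from \<open>x\<close>. The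
  bound along edges shows that no walk of length \<open>k\<close> ends at rank above
  \<open>k\<close>; the descending neighbours build a walk of length \<open>r y\<close>.\<close>

definition rank_from :: "'v graph \<Rightarrow> 'v \<Rightarrow> ('v \<Rightarrow> nat) \<Rightarrow> bool" where
  "rank_from G x r \<longleftrightarrow> x \<in> verts G \<and> r x = 0 \<and> (\<forall>y z. adj G y z \<longrightarrow> r z \<le> Suc (r y)) \<and>
     (\<forall>y\<in>verts G. y \<noteq> x \<longrightarrow> (\<exists>z\<in>verts G. adj G z y \<and> r y = Suc (r z)))"

lemma gdist_eq_rank:
  assumes "rank_from G x r" and "y \<in> verts G"
  shows "gdist G x y = r y"
  unfolding gdist_def
proof (rule Least_equality)
  show "(adj G ^^ r y) x y"
    using assms(2)
  proof (induction "r y" arbitrary: y)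
    case 0
    then have "y = x" using assms(1) by (auto simp: rank_from_def)
    then show ?case using assms(1) by (simp add: rank_from_def)
  next
    case (Suc k)
    then have "y \<noteq> x" using assms(1) by (auto simp: rank_from_def)
    with Suc.prems assms(1) obtain z where z: "z \<in> verts G" "adj G z y" "r y = Suc (r z)"
      by (auto simp: rank_from_def)
    with Suc.hyps have "(adj G ^^ r z) x z" by simp
    with z show ?case by auto
  qed
next
  fix k
  assume "(adj G ^^ k) x y"
  then show "r y \<le> k"
  proof (induction k arbitrary: y)
    case 0
    then show ?case using assms(1) by (simp add: rank_from_def)
  next
    case (Suc k)
    then obtain z where "(adj G ^^ k) x z" "adj G z y" by auto
    with Suc.IH assms(1) show ?case
      unfolding rank_from_def by (meson Suc_le_mono order_trans)
  qed
qed

text \<open>A descending step changes the distance, so its edge survives in \<open>gamma_f\<close>;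
  the bound along edges passes to any subgraph. Hence both graphs have the same distances from
  \<open>x\<close>.\<close>

lemma rank_from_gamma_f:
  assumes "rank_from G x r"
  shows "rank_from (gamma_f G x) x r"
  unfolding rank_from_def
proof (intro conjI ballI impI)
  fix y
  assume "y \<in> verts (gamma_f G x)" "y \<noteq> x"
  then obtain z where "y \<in> verts G" "z \<in> verts G" "adj G z y" "r y = Suc (r z)"
    using assms by (auto simp: rank_from_def gamma_f_def)
  then show "\<exists>z\<in>verts (gamma_f G x). adj (gamma_f G x) z y \<and> r y = Suc (r z)"
    by (intro bexI[of _ z]) (simp_all add: gamma_f_def gdist_eq_rank[OF assms])
qed (use assms in \<open>auto simp: rank_from_def gamma_f_def\<close>)

lemma simple_graph_cart_prod:
  assumes "simple_graph G" and "simple_graph H"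
  shows "simple_graph (cart_prod G H)"
  using assms by (auto simp: simple_graph_def cart_prod_def)

lemma simple_graph_cart_power:
  assumes "simple_graph G"
  shows "simple_graph (cart_power n G)"
  using assms by (auto simp: simple_graph_def cart_power_def intro!: finite_PiE)

lemma rank_from_cart_prod:
  assumes "rank_from G x r" and "rank_from H x' s"
  shows "rank_from (cart_prod G H) (x, x') (\<lambda>y. r (fst y) + s (snd y))"
  unfolding rank_from_def
proof (intro conjI ballI impI)
  fix y
  assume y: "y \<in> verts (cart_prod G H)" "y \<noteq> (x, x')"
  obtain a b where ab: "y = (a, b)" by force
  then have mem: "a \<in> verts G" "b \<in> verts H" using y by (auto simp: cart_prod_def)
  show "\<exists>z\<in>verts (cart_prod G H). adj (cart_prod G H) z y \<and>
      r (fst y) + s (snd y) = Suc (r (fst z) + s (snd z))"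
  proof (cases "a = x")
    case True
    then obtain c where "c \<in> verts H" "adj H c b" "s b = Suc (s c)"
      using y mem ab assms(2) by (auto simp: rank_from_def)
    then show ?thesis using mem ab
      by (intro bexI[of _ "(a, c)"]) (auto simp: cart_prod_def)
  next
    case False
    then obtain c where "c \<in> verts G" "adj G c a" "r a = Suc (r c)"
      using y mem ab assms(1) by (auto simp: rank_from_def)
    then show ?thesis using mem ab
      by (intro bexI[of _ "(c, b)"]) (auto simp: cart_prod_def)
  qed
qed (use assms in \<open>auto simp: rank_from_def cart_prod_def\<close>)

text \<open>Written with an extra summand on each side to avoid subtraction of natural
  numbers.\<close>

lemma sum_fun_upd:
  fixes r :: "'k \<Rightarrow> 'v \<Rightarrow> nat"
  assumes "finite K" and "k \<in> K"
  shows "(\<Sum>j\<in>K. r j ((y(k := b)) j)) + r k (y k) = (\<Sum>j\<in>K. r j (y j)) + r k b"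
  using assms by (simp add: sum.remove[of K k])

text \<open>Parametrises the neighbours by pairs of a coordinate and a new value, as needed for
  reindexing sums. Extensionality makes \<open>y\<close> and \<open>z\<close> agree outside
  \<open>{..<n}\<close>, so differing in one coordinate amounts to a single update.\<close>

lemma adj_cart_power:
  assumes "y \<in> verts (cart_power n G)" and "simple_graph G"
  shows "adj (cart_power n G) y z \<longleftrightarrow> (\<exists>k<n. \<exists>b. adj G (y k) b \<and> z = y(k := b))"
proof
  assume "adj (cart_power n G) y z"
  then obtain k where k: "k < n" "adj G (y k) (z k)" "\<forall>j<n. j \<noteq> k \<longrightarrow> y j = z j"
    and ext: "y \<in> {..<n} \<rightarrow>\<^sub>E verts G" "z \<in> {..<n} \<rightarrow>\<^sub>E verts G"
    by (auto simp: cart_power_def)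
  have "z = y(k := z k)"
  proof
    fix j
    show "z j = (y(k := z k)) j"
      using k(3) ext by (cases "j < n") (auto simp: PiE_def extensional_def)
  qed
  with k show "\<exists>k<n. \<exists>b. adj G (y k) b \<and> z = y(k := b)" by blast
next
  assume "\<exists>k<n. \<exists>b. adj G (y k) b \<and> z = y(k := b)"
  then obtain k b where k: "k < n" "adj G (y k) b" "z = y(k := b)" by blast
  moreover have "b \<in> verts G" using k(2) assms(2) by (auto simp: simple_graph_def)
  ultimately have "z \<in> {..<n} \<rightarrow>\<^sub>E verts G"
    using assms(1) by (auto simp: cart_power_def PiE_def extensional_def)
  then show "adj (cart_power n G) y z"
    using k assms(1) by (auto simp: cart_power_def)
qed

lemma rank_from_cart_power:
  assumes "x \<in> verts (cart_power n G)" and "simple_graph G"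
    and "\<And>k. k < n \<Longrightarrow> rank_from G (x k) (r k)"
  shows "rank_from (cart_power n G) x (\<lambda>y. \<Sum>k<n. r k (y k))"
  unfolding rank_from_def
proof (intro conjI ballI allI impI)
  show "x \<in> verts (cart_power n G)" by fact
  show "(\<Sum>k<n. r k (x k)) = 0" using assms(3) by (simp add: rank_from_def)
next
  fix y z
  assume adj: "adj (cart_power n G) y z"
  then have "y \<in> verts (cart_power n G)" by (simp add: cart_power_def)
  with adj assms(2) obtain k b where "k < n" "adj G (y k) b" "z = y(k := b)"
    by (auto simp: adj_cart_power)
  moreover from this have "r k b \<le> Suc (r k (y k))"
    using assms(3)[of k] by (auto simp: rank_from_def)
  ultimately show "(\<Sum>k<n. r k (z k)) \<le> Suc (\<Sum>k<n. r k (y k))"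
    using sum_fun_upd[of "{..<n}" k r y b] by simp
next
  fix y
  assume y: "y \<in> verts (cart_power n G)" "y \<noteq> x"
  moreover have "y = x" if "\<forall>k<n. y k = x k"
    by (rule PiE_ext[of y "{..<n}" "\<lambda>_. verts G"])
       (use y(1) assms(1) that in \<open>simp_all add: cart_power_def\<close>)
  ultimately obtain k where k: "k < n" "y k \<noteq> x k"
    by blast
  moreover have "y k \<in> verts G" using y(1) k(1) by (auto simp: cart_power_def)
  ultimately obtain b where b: "b \<in> verts G" "adj G b (y k)" "r k (y k) = Suc (r k b)"
    using assms(3)[of k] by (auto simp: rank_from_def)
  let ?z = "y(k := b)"
  have z: "?z \<in> verts (cart_power n G)"
    using y(1) k(1) b(1) by (auto simp: cart_power_def PiE_def extensional_def)
  moreover have "adj (cart_power n G) ?z y"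
    using z k(1) b(2) assms(2) by (auto simp: adj_cart_power intro!: exI[of _ k] exI[of _ "y k"])
  moreover have "(\<Sum>k<n. r k (y k)) = Suc (\<Sum>k<n. r k (?z k))"
    using sum_fun_upd[of "{..<n}" k r y b] k(1) b(3) by simp
  ultimately show "\<exists>z\<in>verts (cart_power n G). adj (cart_power n G) z y \<and>
      (\<Sum>k<n. r k (y k)) = Suc (\<Sum>k<n. r k (z k))"
    by blast
qed

text \<open>The neighbours fall into those moving the first and those moving the second component.
  The two sets are disjoint because the factors have no loops.\<close>

lemma level_sum_cart_prod:
  assumes "simple_graph G" and "simple_graph H" and "y \<in> verts (cart_prod G H)"
    and P: "\<And>i j c. P (i + c) (j + c) = P i j"
  shows "level_sum P (adj (cart_prod G H)) (\<lambda>y. r (fst y) + s (snd y)) f y =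
    level_sum P (adj G) r (\<lambda>b. f (b, snd y)) (fst y) +
    level_sum P (adj H) s (\<lambda>b. f (fst y, b)) (snd y)"
proof -
  obtain a a' where y: "y = (a, a')" by force
  let ?A = "{b. adj G a b \<and> P (r a) (r b)}" and ?B = "{b. adj H a' b \<and> P (s a') (s b)}"
  have "?A \<subseteq> verts G" "?B \<subseteq> verts H"
    using assms(1,2) by (auto simp: simple_graph_def)
  with assms(1,2) have fin: "finite ?A" "finite ?B"
    unfolding simple_graph_def by (meson finite_subset)+
  have P': "P (c + i) (c + j) = P i j" for c i j
    using P[of i c j] by (simp add: add.commute)
  have "{z. adj (cart_prod G H) y z \<and> P (r (fst y) + s (snd y)) (r (fst z) + s (snd z))}
      = (\<lambda>b. (b, a')) ` ?A \<union> (\<lambda>b. (a, b)) ` ?B"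
    using assms by (auto simp: y cart_prod_def simple_graph_def P P')
  moreover have "(\<lambda>b. (b, a')) ` ?A \<inter> (\<lambda>b. (a, b)) ` ?B = {}"
    using assms(1) by (auto simp: simple_graph_def)
  ultimately show ?thesis
    unfolding level_sum_def using fin
    by (simp add: sum.union_disjoint sum.reindex inj_on_def y)
qed

lemma level_sum_cart_power:
  assumes "simple_graph G" and y: "y \<in> verts (cart_power n G)"
    and P: "\<And>i j c. P (i + c) (j + c) = P i j"
  shows "level_sum P (adj (cart_power n G)) (\<lambda>y. \<Sum>k<n. r k (y k)) f y =
    (\<Sum>k<n. level_sum P (adj G) (r k) (\<lambda>b. f (y(k := b))) (y k))"
proof -
  let ?A = "\<lambda>k. {b. adj G (y k) b \<and> P (r k (y k)) (r k b)}"
  let ?S = "Sigma {..<n} ?A" and ?g = "\<lambda>(k, b). y(k := b)"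
  have "?A k \<subseteq> verts G" for k
    using assms(1) by (auto simp: simple_graph_def)
  with assms(1) have fin: "finite (?A k)" for k
    unfolding simple_graph_def by (meson finite_subset)
  \<comment> \<open>Shift both levels by \<open>r k (y k)\<close>, exchange the updated sum by
    \<open>sum_fun_upd\<close>, then cancel the old sum from both sides.\<close>
  have P': "P (\<Sum>j<n. r j (y j)) (\<Sum>j<n. r j ((y(k := b)) j)) \<longleftrightarrow> P (r k (y k)) (r k b)"
    if "k < n" for k b
    using sum_fun_upd[of "{..<n}" k r y b] that
      P[of "\<Sum>j<n. r j (y j)" "r k (y k)" "\<Sum>j<n. r j ((y(k := b)) j)"]
      P[of "r k (y k)" "\<Sum>j<n. r j (y j)" "r k b"]
    by (simp add: add.commute)
  have "{z. adj (cart_power n G) y z \<and> P (\<Sum>k<n. r k (y k)) (\<Sum>k<n. r k (z k))} = ?g ` ?S"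
    unfolding adj_cart_power[OF y assms(1)]
  proof (intro equalityI subsetI)
    fix z
    assume "z \<in> {z. (\<exists>k<n. \<exists>b. adj G (y k) b \<and> z = y(k := b)) \<and>
      P (\<Sum>k<n. r k (y k)) (\<Sum>k<n. r k (z k))}"
    then obtain k b where "k < n" "adj G (y k) b" "z = y(k := b)" "(k, b) \<in> ?S"
      using P' by auto
    then show "z \<in> ?g ` ?S" by (auto intro!: image_eqI[of _ _ "(k, b)"])
  next
    fix z
    assume "z \<in> ?g ` ?S"
    then obtain k b where "k < n" "adj G (y k) b" "z = y(k := b)" "P (r k (y k)) (r k b)"
      by auto
    then show "z \<in> {z. (\<exists>k<n. \<exists>b. adj G (y k) b \<and> z = y(k := b)) \<and>
      P (\<Sum>k<n. r k (y k)) (\<Sum>k<n. r k (z k))}"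
      using P' by blast
  qed
  \<comment> \<open>Since \<open>G\<close> has no loops, a neighbour really differs from
    \<open>y\<close> in the coordinate \<open>k\<close>, which therefore can be recovered from
    it.\<close>
  moreover have "inj_on ?g ?S"
  proof (rule inj_onI, clarsimp)
    fix k b k' b'
    assume "adj G (y k) b" "adj G (y k') b'" and eq: "y(k := b) = y(k' := b')"
    then have "b \<noteq> y k" using assms(1) by (auto simp: simple_graph_def)
    with eq show "k = k' \<and> b = b'" by (metis fun_upd_apply)
  qed
  ultimately show ?thesis
    unfolding level_sum_def using fin
    by (simp add: sum.reindex sum.Sigma case_prod_unfold)
qed

section \<open>The Doob graph\<close>

text \<open>The graph has diameter two: every remaining element is a sum of two connection elements.
  Restricting the witness to an explicit list makes this a finite check.\<close>

lemma shrikhande_common_neighbour: "b \<notin> shrikhande_conn \<Longrightarrow> b \<noteq> 0 \<Longrightarrow>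
    \<exists>a. a \<in> shrikhande_conn \<and> b - a \<in> shrikhande_conn"
proof -
  have "\<forall>b. b \<in> shrikhande_conn \<or> b = 0 \<or>
      (\<exists>a\<in>{(1, 0), (3, 0), (0, 1), (0, 3), (1, 1), (3, 3)}.
        a \<in> shrikhande_conn \<and> b - a \<in> shrikhande_conn)"
    unfolding split_paired_All all_4 by (simp add: mem_shrikhande_conn zero_prod_def)
  then show "b \<notin> shrikhande_conn \<Longrightarrow> b \<noteq> 0 \<Longrightarrow> ?thesis" by blast
qed

lemma simple_graph_shrikhande: "simple_graph shrikhande"
  by (auto simp: simple_graph_def adj_shrikhande shrikhande_conn_def zero_prod_def)
     (simp_all add: shrikhande_def cayley_graph_def)

lemma simple_graph_K4: "simple_graph K4"
  by (simp add: simple_graph_def K4_def)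

lemma verts_shrikhande: "verts shrikhande = UNIV"
  by (simp add: shrikhande_def cayley_graph_def)

lemma rank_from_shrikhande: "rank_from shrikhande c (\<lambda>b. shrikhande_rank (b - c))"
  unfolding rank_from_def adj_shrikhande verts_shrikhande
proof (intro conjI allI ballI impI)
  fix y z
  assume "z - y \<in> shrikhande_conn"
  \<comment> \<open>Ranks are at most 2, so only a jump from 0 to 2 could fail; but rank 0 means
    \<open>y = c\<close>, and then \<open>z - c\<close> is a connection element.\<close>
  then show "shrikhande_rank (z - c) \<le> Suc (shrikhande_rank (y - c))"
    by (auto simp: shrikhande_rank_def)
next
  fix y
  assume "y \<noteq> c"
  show "\<exists>z\<in>UNIV. y - z \<in> shrikhande_conn \<and>
      shrikhande_rank (y - c) = Suc (shrikhande_rank (z - c))"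
  proof (cases "y - c \<in> shrikhande_conn")
    case True
    then show ?thesis using \<open>y \<noteq> c\<close>
      by (intro bexI[of _ c]) (auto simp: shrikhande_rank_def)
  next
    case False
    then obtain a where a: "a \<in> shrikhande_conn" "y - c - a \<in> shrikhande_conn"
      using shrikhande_common_neighbour[of "y - c"] \<open>y \<noteq> c\<close> by auto
    then show ?thesis using False \<open>y \<noteq> c\<close>
      by (intro bexI[of _ "c + a"]) (auto simp: shrikhande_rank_def algebra_simps)
  qed
qed (simp_all add: shrikhande_rank_def)

lemma rank_from_K4: "rank_from K4 c (\<lambda>b. K4_rank (b - c))"
  by (auto simp: rank_from_def K4_def K4_rank_def)

definition doob_rank where
  "doob_rank n m x y = (\<Sum>k<n. shrikhande_rank (fst y k - fst x k)) +
     (\<Sum>k<m. K4_rank (snd y k - snd x k))"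

lemma simple_graph_doob: "simple_graph (doob n m)"
  unfolding doob_def
  by (intro simple_graph_cart_prod simple_graph_cart_power simple_graph_shrikhande simple_graph_K4)

lemma rank_from_doob:
  assumes "x \<in> verts (doob n m)"
  shows "rank_from (doob n m) x (doob_rank n m x)"
proof -
  have "fst x \<in> verts (cart_power n shrikhande)" "snd x \<in> verts (cart_power m K4)"
    using assms by (auto simp: doob_def cart_prod_def)
  then have "rank_from (cart_prod (cart_power n shrikhande) (cart_power m K4)) (fst x, snd x)
      (\<lambda>y. (\<Sum>k<n. shrikhande_rank (fst y k - fst x k)) + (\<Sum>k<m. K4_rank (snd y k - snd x k)))"
    by (intro rank_from_cart_prod rank_from_cart_power simple_graph_shrikhande simple_graph_K4
        rank_from_shrikhande rank_from_K4)
  then show ?thesis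
    by (simp add: doob_def doob_rank_def[abs_def])
qed

lemma level_sum_doob:
  assumes "y \<in> verts (doob n m)" and P: "\<And>i j c. P (i + c) (j + c) = P i j"
  shows "level_sum P (adj (doob n m)) (doob_rank n m x) f y = doob_op P n m x f y"
proof -
  have "fst y \<in> verts (cart_power n shrikhande)" "snd y \<in> verts (cart_power m K4)"
    using assms(1) by (auto simp: doob_def cart_prod_def)
  note level =
    level_sum_cart_power[where P = P and r = "\<lambda>k b. shrikhande_rank (b - fst x k)",
      OF simple_graph_shrikhande this(1) P]
    level_sum_cart_power[where P = P and r = "\<lambda>k b. K4_rank (b - snd x k)",
      OF simple_graph_K4 this(2) P]
  have "level_sum P (adj (doob n m)) (doob_rank n m x) f y
    = level_sum P (adj (cart_power n shrikhande)) (\<lambda>y. \<Sum>k<n. shrikhande_rank (y k - fst x k))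
        (\<lambda>b. f (b, snd y)) (fst y)
    + level_sum P (adj (cart_power m K4)) (\<lambda>y. \<Sum>k<m. K4_rank (y k - snd x k))
        (\<lambda>b. f (fst y, b)) (snd y)"
    unfolding doob_def doob_rank_def[abs_def]
    by (rule level_sum_cart_prod)
       (use assms in \<open>simp_all add: doob_def simple_graph_cart_power simple_graph_shrikhande
          simple_graph_K4\<close>)
  also have "\<dots> = doob_op P n m x f y"
    by (simp add: level doob_op_def sum.Plus coord_op_def lift_def)
  finally show ?thesis .
qed

lemma doob_rank_le: "doob_rank n m x y \<le> 2 * n + m"
proof -
  have "(\<Sum>k<n. shrikhande_rank (fst y k - fst x k)) \<le> (\<Sum>k<n. 2)"
    by (rule sum_mono) (simp add: shrikhande_rank_def)
  moreover have "(\<Sum>k<m. K4_rank (snd y k - snd x k)) \<le> (\<Sum>k<m. 1)"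
    by (rule sum_mono) (simp add: K4_rank_def)
  ultimately show ?thesis by (simp add: doob_rank_def)
qed

lemma gdist_doob:
  assumes "x \<in> verts (doob n m)" and "y \<in> verts (doob n m)"
  shows "gdist (doob n m) x y = doob_rank n m x y"
  using gdist_eq_rank[OF rank_from_doob] assms by blast

lemma diameter_doob: "diameter (doob n m) = 2 * n + m"
  unfolding diameter_def
proof (rule Max_eqI)
  let ?V = "verts (doob n m)"
  have "{gdist (doob n m) y z | y z. y \<in> ?V \<and> z \<in> ?V}
      = (\<lambda>(y, z). gdist (doob n m) y z) ` (?V \<times> ?V)"
    by auto
  then show "finite {gdist (doob n m) y z | y z. y \<in> ?V \<and> z \<in> ?V}"
    using simple_graph_doob[of n m] by (simp add: simple_graph_def)
  show "d \<le> 2 * n + m" if "d \<in> {gdist (doob n m) y z | y z. y \<in> ?V \<and> z \<in> ?V}" for d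
    using that gdist_doob doob_rank_le by auto
  \<comment> \<open>A pair of vertices at maximal distance: (2, 2) has rank 2 in each Shrikhande
    coordinate and 1 has rank 1 in each K4 coordinate.\<close>
  let ?y = "(\<lambda>k\<in>{..<n}. (0, 0) :: 4 \<times> 4, \<lambda>k\<in>{..<m}. 0 :: 4)"
  let ?z = "(\<lambda>k\<in>{..<n}. (2, 2) :: 4 \<times> 4, \<lambda>k\<in>{..<m}. 1 :: 4)"
  have "?y \<in> ?V" "?z \<in> ?V"
    by (auto simp: doob_def cart_prod_def cart_power_def verts_shrikhande K4_def)
  moreover have "doob_rank n m ?y ?z = 2 * n + m"
  proof -
    have "shrikhande_rank (2, 2) = 2" "K4_rank 1 = 1"
      by (simp_all add: shrikhande_rank_def mem_shrikhande_conn K4_rank_def zero_prod_def)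
    then show ?thesis by (simp add: doob_rank_def)
  qed
  ultimately have "gdist (doob n m) ?y ?z = 2 * n + m" "?y \<in> ?V" "?z \<in> ?V"
    using gdist_doob by simp_all
  then show "2 * n + m \<in> {gdist (doob n m) y z | y z. y \<in> ?V \<and> z \<in> ?V}"
    by (metis (mono_tags, lifting) mem_Collect_eq)
qed

section \<open>Lowering and raising matrices\<close>

lemma level_sum_eq_0:
  assumes "\<And>b. E a b \<Longrightarrow> P (r a) (r b) \<Longrightarrow> f b = 0"
  shows "level_sum P E r f a = 0"
  unfolding level_sum_def by (rule sum.neutral) (simp add: assms)

lemma mvec_mmul: "mvec G (mmul G M N) v = mvec G M (mvec G N v)"
  unfolding mvec_def mmul_def
  by (rule ext) (simp add: sum_distrib_left sum_distrib_right mult.assoc,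
    rule sum.swap)

lemma dual_idem_mult_adj_mat:
  assumes "simple_graph G"
  shows "mmul G (dual_idem G x j) (mmul G (adj_mat G) (dual_idem G x i)) y z =
    (if adj G y z \<and> gdist G x y = j \<and> gdist G x z = i then 1 else 0)"
proof -
  have fin: "finite (verts G)" and mem: "adj G y z \<Longrightarrow> y \<in> verts G \<and> z \<in> verts G"
    using assms by (auto simp: simple_graph_def)
  have dual: "dual_idem G x i u w =
      (if u = w then if w \<in> verts G \<and> gdist G x w = i then 1 else 0 else 0)" for i u w
    by (auto simp: dual_idem_def)
  have "mmul G (adj_mat G) (dual_idem G x i) w z =
      (if adj G w z \<and> w \<in> verts G \<and> z \<in> verts G \<and> gdist G x z = i then 1 else 0)" for w
    unfolding mmul_def dual adj_mat_def using fin
    by (simp add: if_distrib[of "\<lambda>c. _ * c"] cong: if_cong)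
  moreover have "dual_idem G x j y w * c =
      (if y = w then if y \<in> verts G \<and> gdist G x y = j then c else 0 else 0)" for w c
    by (simp add: dual)
  ultimately show ?thesis
    unfolding mmul_def[of G "dual_idem G x j"] using fin mem
    by auto
qed

text \<open>The column vertex fixes the only index \<open>i\<close> that can contribute. The
  comparison with \<open>D\<close> records where the defining sum stops;
  \<open>mvec_lowering\<close> absorbs it once \<open>D\<close> bounds all distances.\<close>

lemma lowering_entry:
  assumes "simple_graph G"
  shows "lowering G x D y z =
    (if adj G y z \<and> gdist G x z = Suc (gdist G x y) \<and> gdist G x z \<le> D then 1 else 0)"
proof -
  have "lowering G x D y z = (\<Sum>i = 1..D. if i = gdist G x z then
      if adj G y z \<and> gdist G x z = Suc (gdist G x y) then 1 else 0 else 0)"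
    unfolding lowering_def dual_idem_mult_adj_mat[OF assms] by (rule sum.cong) auto
  then show ?thesis by simp
qed

lemma raising_entry:
  assumes "simple_graph G"
  shows "raising G x D y z =
    (if adj G y z \<and> gdist G x y = Suc (gdist G x z) \<and> gdist G x y \<le> D then 1 else 0)"
proof -
  have "raising G x D y z = (\<Sum>i<D. if i = gdist G x z then
      if adj G y z \<and> gdist G x y = Suc (gdist G x z) then 1 else 0 else 0)"
    unfolding raising_def dual_idem_mult_adj_mat[OF assms] by (rule sum.cong) auto
  then show ?thesis by auto
qed

lemma mvec_indicator:
  assumes "simple_graph G"
    and "\<And>y z. M y z = (if adj G y z \<and> P (r y) (r z) then 1 else 0)"
  shows "mvec G M v = level_sum P (adj G) r v"
proof
  fix y
  have "mvec G M v y = (\<Sum>z\<in>verts G. if adj G y z \<and> P (r y) (r z) then v z else 0)"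
    unfolding mvec_def by (rule sum.cong) (auto simp: assms(2))
  also have "\<dots> = (\<Sum>z | z \<in> verts G \<and> adj G y z \<and> P (r y) (r z). v z)"
    using assms(1) by (simp add: sum.inter_filter simple_graph_def)
  also have "{z. z \<in> verts G \<and> adj G y z \<and> P (r y) (r z)} = {z. adj G y z \<and> P (r y) (r z)}"
    using assms(1) by (auto simp: simple_graph_def)
  finally show "mvec G M v y = level_sum P (adj G) r v y"
    by (simp add: level_sum_def)
qed

lemma mvec_lowering:
  assumes "simple_graph G" and "\<And>z. z \<in> verts G \<Longrightarrow> gdist G x z \<le> D"
  shows "mvec G (lowering G x D) v = lower_op (adj G) (gdist G x) v"
proof (rule mvec_indicator[OF assms(1)])
  fix y z
  have "gdist G x y \<le> D \<and> gdist G x z \<le> D" if "adj G y z"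
    using that assms by (meson simple_graph_def)
  then show "lowering G x D y z = (if adj G y z \<and> gdist G x z = Suc (gdist G x y) then 1 else 0)"
    using assms(1) by (auto simp: lowering_entry)
qed

lemma mvec_raising:
  assumes "simple_graph G" and "\<And>z. z \<in> verts G \<Longrightarrow> gdist G x z \<le> D"
  shows "mvec G (raising G x D) v = raise_op (adj G) (gdist G x) v"
proof (rule mvec_indicator[OF assms(1)])
  fix y z
  have "gdist G x y \<le> D \<and> gdist G x z \<le> D" if "adj G y z"
    using that assms by (meson simple_graph_def)
  then show "raising G x D y z = (if adj G y z \<and> gdist G x y = Suc (gdist G x z) then 1 else 0)"
    using assms(1) by (auto simp: raising_entry)
qed

lemma subconstituent_eq_0:
  assumes "v \<in> subconstituent G x i" and "gdist G x y \<noteq> i"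
  shows "v y = 0"
  using assms unfolding subconstituent_def mvec_def dual_idem_def
  by (auto intro!: sum.neutral)

text \<open>The square of the lowering operator reads \<open>v\<close> only at distance two or
  more.\<close>

lemma lower_lower_eq_0:
  assumes "v \<in> subconstituent G x 1"
  shows "lower_op (adj G) (gdist G x) (lower_op (adj G) (gdist G x) v) = (\<lambda>_. 0)"
  by (intro ext level_sum_eq_0 subconstituent_eq_0[OF assms]) simp

lemma raise_eq_0:
  assumes "v \<in> subconstituent G x D" and "simple_graph G"
    and "\<And>z. z \<in> verts G \<Longrightarrow> gdist G x z \<le> D"
  shows "raise_op (adj G) (gdist G x) v = (\<lambda>_. 0)"
proof (intro ext level_sum_eq_0 subconstituent_eq_0[OF assms(1)])
  fix y b
  assume "adj G y b" "gdist G x y = Suc (gdist G x b)"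
  moreover from this have "gdist G x y \<le> D"
    using assms(2,3) by (meson simple_graph_def)
  ultimately show "gdist G x b \<noteq> D" by simp
qed

lemma simple_graph_gamma_f: "simple_graph G \<Longrightarrow> simple_graph (gamma_f G x)"
  by (auto simp: simple_graph_def gamma_f_def)

text \<open>Entries of the lowering and raising matrices live on edges between different levels,
  which are exactly the edges that \<open>gamma_f\<close> keeps. The certificate \<open>r\<close>
  provides the agreement of distances.\<close>

lemma
  assumes "simple_graph G" and "rank_from G x r"
  shows lowering_gamma_f: "lowering (gamma_f G x) x D = lowering G x D"
    and raising_gamma_f: "raising (gamma_f G x) x D = raising G x D"
    and subconstituent_gamma_f: "subconstituent (gamma_f G x) x i = subconstituent G x i"
proof -
  have verts: "verts (gamma_f G x) = verts G"
    by (simp add: gamma_f_def)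
  have gdist: "gdist (gamma_f G x) x y = gdist G x y" if "y \<in> verts G" for y
    using gdist_eq_rank[OF assms(2) that] gdist_eq_rank[OF rank_from_gamma_f[OF assms(2)], of y] that
    by (simp add: verts)
  have adj: "adj (gamma_f G x) y z \<longleftrightarrow> adj G y z \<and> y \<in> verts G \<and> z \<in> verts G \<and>
      gdist G x y \<noteq> gdist G x z" for y z
    using assms(1) by (auto simp: gamma_f_def simple_graph_def)
  have mem: "adj G y z \<Longrightarrow> y \<in> verts G \<and> z \<in> verts G" for y z
    using assms(1) by (auto simp: simple_graph_def)
  show "lowering (gamma_f G x) x D = lowering G x D"
    by (intro ext) (auto simp: lowering_entry simple_graph_gamma_f assms(1) adj gdist dest: mem)
  show "raising (gamma_f G x) x D = raising G x D"
    by (intro ext) (auto simp: raising_entry simple_graph_gamma_f assms(1) adj gdist dest: mem)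
  have "dual_idem (gamma_f G x) x i = dual_idem G x i"
    by (intro ext) (auto simp: dual_idem_def verts gdist)
  then show "subconstituent (gamma_f G x) x i = subconstituent G x i"
    by (simp add: subconstituent_def standard_module_def mvec_def[abs_def] verts)
qed

section \<open>The parameter matrix\<close>

text \<open>Half of the Cartan matrix of type A, with determinant (D + 1) / 2^D. Being constant
  along diagonals, it has smaller matrices of the same family as its contiguous principal
  submatrices.\<close>

definition toeplitz :: "nat \<Rightarrow> complex mat" where
  "toeplitz D = mat D D (\<lambda>(i, j).
     if i = j then 1 else if i = Suc j \<or> j = Suc i then - (1 / 2) else 0)"

text \<open>
  The coordinates of a kernel vector, extended by \<open>0\<close> on the right, form an arithmetic
  progression \<open>w 0, 2 * w 0, 3 * w 0, \<dots>\<close>.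
\<close>

lemma det_toeplitz: "det (toeplitz k) \<noteq> 0"
proof
  assume "det (toeplitz k) = 0"
  moreover have carrier: "toeplitz k \<in> carrier_mat k k"
    by (simp add: toeplitz_def)
  ultimately obtain v where v: "v \<in> carrier_vec k" "v \<noteq> 0\<^sub>v k" "toeplitz k *\<^sub>v v = 0\<^sub>v k"
    using det_0_iff_vec_prod_zero by blast
  define w where "w j = (if j < k then v $ j else 0)" for j
  have row: "w (Suc i) = 2 * w i - (case i of 0 \<Rightarrow> 0 | Suc j \<Rightarrow> w j)" if i: "i < k" for i
  proof -
    have "0 = (toeplitz k *\<^sub>v v) $ i"
      using v(3) i by simp
    also have "\<dots> = (\<Sum>j = 0..<k. toeplitz k $$ (i, j) * v $ j)"
      using i v(1) carrier by (simp add: scalar_prod_def)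
    also have "\<dots> = (\<Sum>j = 0..<k. (if j = i then w j else 0) +
        (if j = Suc i then - (1 / 2) * w j else 0) + (if Suc j = i then - (1 / 2) * w j else 0))"
      using i by (intro sum.cong) (auto simp: toeplitz_def w_def)
    also have "\<dots> = w i - 1 / 2 * w (Suc i) - 1 / 2 * (case i of 0 \<Rightarrow> 0 | Suc j \<Rightarrow> w j)"
      using i by (auto simp: sum.distrib w_def split: nat.split)
    also have "\<dots> = (2 * w i - w (Suc i) - (case i of 0 \<Rightarrow> 0 | Suc j \<Rightarrow> w j)) / 2"
      by (simp add: field_simps)
    finally have "2 * w i - w (Suc i) - (case i of 0 \<Rightarrow> 0 | Suc j \<Rightarrow> w j) = 0"
      by simp
    then show ?thesis by (simp add: algebra_simps)
  qed
  \<comment> \<open>The range includes \<open>i = k\<close>: the last row of the system determines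
    the padded entry \<open>w k\<close>. As this entry is 0 by definition, \<open>k + 1\<close>
    times \<open>w 0\<close> vanishes, and so does \<open>w 0\<close>.\<close>
  have w: "i \<le> k \<Longrightarrow> w i = of_nat (Suc i) * w 0" for i
  proof (induction i rule: less_induct)
    case (less i)
    show ?case
    proof (cases i)
      case (Suc j)
      show ?thesis
      proof (cases j)
        case 0
        then show ?thesis using row[of 0] less.prems Suc by simp
      next
        case (Suc l)
        then have "w j = of_nat (Suc j) * w 0" "w l = of_nat (Suc l) * w 0"
          using less.IH[of j] less.IH[of l] less.prems \<open>i = Suc j\<close> by simp_all
        moreover have "w i = 2 * w j - w l"
          using row[of j] less.prems \<open>i = Suc j\<close> Suc by simp
        ultimately show ?thesis
          using \<open>i = Suc j\<close> Suc by (simp add: algebra_simps)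
      qed
    qed simp
  qed
  have "of_nat (Suc k) * w 0 = 0"
    using w[of k] by (simp add: w_def)
  then have "w 0 = 0"
    by (simp del: of_nat_Suc)
  have "v = 0\<^sub>v k"
  proof (rule eq_vecI)
    fix i
    assume "i < dim_vec (0\<^sub>v k :: complex vec)"
    then show "v $ i = 0\<^sub>v k $ i"
      using w[of i] \<open>w 0 = 0\<close> by (simp add: w_def)
  qed (use v(1) in simp)
  with v(2) show False ..
qed

text \<open>\<open>pick\<close> lists a set in increasing order and translates submatrix indices
  into original ones; on an interval it is a shift.\<close>

lemma pick_atLeastAtMost: "i \<le> b - a \<Longrightarrow> a \<le> b \<Longrightarrow> pick {a..b} i = a + i"
proof (induction i)
  case 0
  then show ?case by (auto intro!: Least_equality)
next
  case (Suc i)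
  then have "pick {a..b} i = a + i" by simp
  with Suc.prems show ?case by (auto intro!: Least_equality)
qed

lemma submatrix_toeplitz:
  assumes "a \<le> b" and "b < D"
  shows "submatrix (toeplitz D) {a..b} {a..b} = toeplitz (Suc b - a)"
proof -
  have "{i. i < D \<and> i \<in> {a..b}} = {a..b}" using assms by auto
  then have card: "card {i. i < D \<and> i \<in> {a..b}} = Suc b - a" by simp
  show ?thesis
  proof (rule eq_matI)
    fix i j
    assume "i < dim_row (toeplitz (Suc b - a))" "j < dim_col (toeplitz (Suc b - a))"
    then have ij: "i < Suc b - a" "j < Suc b - a" by (simp_all add: toeplitz_def)
    then have "submatrix (toeplitz D) {a..b} {a..b} $$ (i, j) = toeplitz D $$ (a + i, a + j)"
      using card assms by (subst submatrix_index) (simp_all add: toeplitz_def pick_atLeastAtMost)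
    also have "\<dots> = toeplitz (Suc b - a) $$ (i, j)"
      using ij assms by (simp add: toeplitz_def)
    finally show "submatrix (toeplitz D) {a..b} {a..b} $$ (i, j) = toeplitz (Suc b - a) $$ (i, j)" .
  qed (use card in \<open>simp_all add: dim_submatrix toeplitz_def\<close>)
qed

lemma e_minus_toeplitz:
  assumes "i \<in> {1..D}"
  shows "e_minus (toeplitz D) i = (if i = 1 then 0 else - (1 / 2))"
  using assms by (auto simp: e_minus_def entry_def toeplitz_def)

lemma e_plus_toeplitz:
  assumes "i \<in> {1..D}"
  shows "e_plus (toeplitz D) i = (if i = D then 0 else - (1 / 2))"
  using assms by (auto simp: e_plus_def entry_def toeplitz_def)

lemma parameter_matrix_toeplitz: "parameter_matrix D (toeplitz D)"
  unfolding parameter_matrix_def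
proof (intro conjI allI impI)
  show "toeplitz D \<in> carrier_mat D D"
    by (simp add: toeplitz_def)
  show "\<forall>i\<in>{1..D}. \<forall>j\<in>{1..D}. i + 1 < j \<or> j + 1 < i \<longrightarrow> entry (toeplitz D) i j = 0"
    by (auto simp: entry_def toeplitz_def)
  show "\<forall>i\<in>{1..D}. entry (toeplitz D) i i = 1"
    by (auto simp: entry_def toeplitz_def)
  have "\<forall>i\<in>{2..D}. entry (toeplitz D) i (i - 1) \<noteq> 0"
    by (auto simp: entry_def toeplitz_def split: if_splits)
  then show "(\<forall>i\<in>{2..D}. entry (toeplitz D) i (i - 1) \<noteq> 0) \<or>
      (\<forall>i\<in>{2..D}. entry (toeplitz D) (i - 1) i \<noteq> 0)" ..
next
  fix s t
  assume "1 \<le> s \<and> s \<le> t \<and> t \<le> D"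
  then show "det (submatrix (toeplitz D) {s - 1..t - 1} {s - 1..t - 1}) \<noteq> 0"
    by (subst submatrix_toeplitz) (auto simp: det_toeplitz)
qed

section \<open>The uniform structure of the Doob graph\<close>

lemma level_sum_gdist_doob:
  assumes "x \<in> verts (doob n m)" and "y \<in> verts (doob n m)"
    and "\<And>i j c. P (i + c) (j + c) = P i j"
  shows "level_sum P (adj (doob n m)) (gdist (doob n m) x) f y = doob_op P n m x f y"
proof -
  have "b \<in> verts (doob n m)" if "adj (doob n m) y b" for b
    using simple_graph_doob[of n m] that by (meson simple_graph_def)
  then have "level_sum P (adj (doob n m)) (gdist (doob n m) x) f y
      = level_sum P (adj (doob n m)) (doob_rank n m x) f y"
    unfolding level_sum_def using assms(1,2) by (intro sum.cong) (auto simp: gdist_doob)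
  also have "\<dots> = doob_op P n m x f y"
    by (rule level_sum_doob) (fact assms)+
  finally show ?thesis .
qed

text \<open>The two kinds of operators agree only at vertices, so they are exchanged one at a time,
  each evaluation at a vertex reading values at vertices only. Three independent predicates cover
  all orders of L and R in the identity.\<close>

lemma level_sum3_gdist_doob:
  assumes x: "x \<in> verts (doob n m)" and y: "y \<in> verts (doob n m)"
    and P: "\<And>i j c. P (i + c) (j + c) = P i j"
    and Q: "\<And>i j c. Q (i + c) (j + c) = Q i j"
    and S: "\<And>i j c. S (i + c) (j + c) = S i j"
  defines "T \<equiv> \<lambda>P. level_sum P (adj (doob n m)) (gdist (doob n m) x)"
  shows "T P (T Q (T S f)) y = doob_op P n m x (doob_op Q n m x (doob_op S n m x f)) y"
proof -
  have mem: "b \<in> verts (doob n m)" if "adj (doob n m) a b" for a b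
    using simple_graph_doob[of n m] that by (meson simple_graph_def)
  have "T Q (T S f) z = T Q (doob_op S n m x f) z" for z
    unfolding T_def by (intro level_sum_cong level_sum_gdist_doob x S mem)
  then have "T P (T Q (T S f)) y = T P (T Q (doob_op S n m x f)) y"
    by presburger
  also have "\<dots> = T P (doob_op Q n m x (doob_op S n m x f)) y"
    unfolding T_def by (intro level_sum_cong level_sum_gdist_doob x Q mem)
  also have "\<dots> = doob_op P n m x (doob_op Q n m x (doob_op S n m x f)) y"
    unfolding T_def by (intro level_sum_gdist_doob x y P)
  finally show ?thesis .
qed

lemma uniform_identity_doob:
  assumes "x \<in> verts (doob n m)" and "y \<in> verts (doob n m)"
  defines "L \<equiv> lower_op (adj (doob n m)) (gdist (doob n m) x)"
    and "R \<equiv> raise_op (adj (doob n m)) (gdist (doob n m) x)"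
  shows "- (1 / 2) * R (L (L v)) y + L (R (L v)) y - 1 / 2 * L (L (R v)) y = 3 * L v y"
proof -
  let ?L = "doob_op up n m x" and ?R = "doob_op down n m x"
  have "L (L (R v)) y = ?L (?L (?R v)) y" "L (R (L v)) y = ?L (?R (?L v)) y"
    "R (L (L v)) y = ?R (?L (?L v)) y"
    unfolding L_def R_def by (rule level_sum3_gdist_doob[OF assms(1,2)]; simp)+
  moreover have "L v y = ?L v y"
    unfolding L_def by (rule level_sum_gdist_doob[OF assms(1,2)]) simp
  moreover have "?L (?L (?R v)) y - 2 * ?L (?R (?L v)) y + ?R (?L (?L v)) y = - 6 * ?L v y"
    using uniform_pair_doob_op unfolding uniform_pair_def by blast
  ultimately have "L (L (R v)) y - 2 * L (R (L v)) y + R (L (L v)) y = - 6 * L v y"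
    by simp
  then have "- (1 / 2) * (L (L (R v)) y - 2 * L (R (L v)) y + R (L (L v)) y) = 3 * L v y"
    by simp
  then show ?thesis by (simp add: algebra_simps)
qed

theorem theorem9p7:
  fixes n m D :: nat
    and \<Gamma> :: "((nat \<Rightarrow> 4 \<times> 4) \<times> (nat \<Rightarrow> 4)) graph"
    and x :: "(nat \<Rightarrow> 4 \<times> 4) \<times> (nat \<Rightarrow> 4)"
    and L R :: "((nat \<Rightarrow> 4 \<times> 4) \<times> (nat \<Rightarrow> 4)) vmat"
  assumes "n \<ge> 1"
    and "D = 2 * n + m"
    and "D \<ge> 3"
    and "\<Gamma> = doob n m"
    and "x \<in> verts \<Gamma>"
    and "L = lowering \<Gamma> x D"
    and "R = raising \<Gamma> x D"
  shows "(\<forall>i\<in>{1..D}. \<forall>v\<in>subconstituent \<Gamma> x i. \<forall>y\<in>verts \<Gamma>.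
            - (1 / 2) * mvec \<Gamma> (mmul \<Gamma> R (mmul \<Gamma> L L)) v y
              + mvec \<Gamma> (mmul \<Gamma> L (mmul \<Gamma> R L)) v y
              - 1 / 2 * mvec \<Gamma> (mmul \<Gamma> L (mmul \<Gamma> L R)) v y
            = 3 * mvec \<Gamma> L v y) \<and>
         supports_strongly_uniform \<Gamma> x \<and>
         (\<exists>U f. strongly_uniform_structure (gamma_f \<Gamma> x) x (diameter \<Gamma>) U f \<and>
            (\<forall>i\<in>{2..D}. e_minus U i = - (1 / 2)) \<and>
            (\<forall>i\<in>{1..D - 1}. e_plus U i = - (1 / 2)) \<and>
            (\<forall>i\<in>{1..D}. coord f i = 3))"
proof -
  let ?f = "vec D (\<lambda>_. 3) :: complex vec"
  have simple: "simple_graph \<Gamma>"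
    using assms(4) simple_graph_doob by simp
  have le: "gdist \<Gamma> x z \<le> D" if "z \<in> verts \<Gamma>" for z
    using assms(2,4,5) that by (simp add: gdist_doob doob_rank_le)
  have rank: "rank_from \<Gamma> x (doob_rank n m x)"
    using assms(4,5) by (simp add: rank_from_doob)
  have mvec_L: "mvec \<Gamma> L v = lower_op (adj \<Gamma>) (gdist \<Gamma> x) v" for v
    unfolding assms(6) by (rule mvec_lowering[OF simple le])
  have mvec_R: "mvec \<Gamma> R v = raise_op (adj \<Gamma>) (gdist \<Gamma> x) v" for v
    unfolding assms(7) by (rule mvec_raising[OF simple le])
  \<comment> \<open>Stated for all \<open>v\<close> at once, so that it serves every level
    \<open>i\<close>; membership in a subconstituent enters below, where the boundary coefficients
    are replaced.\<close>
  have identity: "- (1 / 2) * mvec \<Gamma> (mmul \<Gamma> R (mmul \<Gamma> L L)) v y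
      + mvec \<Gamma> (mmul \<Gamma> L (mmul \<Gamma> R L)) v y
      - 1 / 2 * mvec \<Gamma> (mmul \<Gamma> L (mmul \<Gamma> L R)) v y = 3 * mvec \<Gamma> L v y"
    if "y \<in> verts \<Gamma>" for v y
    unfolding mvec_mmul mvec_L mvec_R
    using uniform_identity_doob[of x n m y v] assms(4,5) that by simp
  have verts: "verts (gamma_f \<Gamma> x) = verts \<Gamma>"
    by (simp add: gamma_f_def)
  have mmul: "mmul (gamma_f \<Gamma> x) = mmul \<Gamma>" and mvec: "mvec (gamma_f \<Gamma> x) = mvec \<Gamma>"
    by (simp_all add: mmul_def mvec_def verts fun_eq_iff)
  have "e_minus (toeplitz D) i * mvec \<Gamma> (mmul \<Gamma> R (mmul \<Gamma> L L)) v y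
      + mvec \<Gamma> (mmul \<Gamma> L (mmul \<Gamma> R L)) v y
      + e_plus (toeplitz D) i * mvec \<Gamma> (mmul \<Gamma> L (mmul \<Gamma> L R)) v y
      = coord ?f i * mvec \<Gamma> L v y"
    if i: "i \<in> {1..D}" and v: "v \<in> subconstituent \<Gamma> x i" and y: "y \<in> verts \<Gamma>" for i v y
  proof -
    have zero: "level_sum P (adj \<Gamma>) r (\<lambda>_. 0) = (\<lambda>_. 0)" for P r
      by (intro ext level_sum_eq_0 refl)
    have "e_minus (toeplitz D) i * mvec \<Gamma> (mmul \<Gamma> R (mmul \<Gamma> L L)) v y
        = - (1 / 2) * mvec \<Gamma> (mmul \<Gamma> R (mmul \<Gamma> L L)) v y"
      using v by (cases "i = 1")
        (simp_all add: e_minus_toeplitz[OF i] mvec_mmul mvec_L mvec_R lower_lower_eq_0 zero)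
    moreover have "e_plus (toeplitz D) i * mvec \<Gamma> (mmul \<Gamma> L (mmul \<Gamma> L R)) v y
        = - (1 / 2) * mvec \<Gamma> (mmul \<Gamma> L (mmul \<Gamma> L R)) v y"
      using v by (cases "i = D")
        (simp_all add: e_plus_toeplitz[OF i] mvec_mmul mvec_L mvec_R raise_eq_0 simple le zero)
    moreover have "coord ?f i = 3"
      using i by (auto simp: coord_def)
    ultimately show ?thesis
      using identity[OF y, of v] by simp
  qed
  then have "uniform_structure (gamma_f \<Gamma> x) x D (toeplitz D) ?f"
    by (simp add: uniform_structure_def parameter_matrix_toeplitz Let_def verts mmul mvec
        lowering_gamma_f[OF simple rank] raising_gamma_f[OF simple rank]
        subconstituent_gamma_f[OF simple rank] assms(6,7))
  moreover have minus: "\<forall>i\<in>{2..D}. e_minus (toeplitz D) i = - (1 / 2)"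
    and plus: "\<forall>i\<in>{1..D - 1}. e_plus (toeplitz D) i = - (1 / 2)"
    by (auto simp: e_minus_toeplitz e_plus_toeplitz)
  moreover have "diameter \<Gamma> = D"
    using assms(2,4) by (simp add: diameter_doob)
  ultimately have
    "strongly_uniform_structure (gamma_f \<Gamma> x) x (diameter \<Gamma>) (toeplitz D) ?f"
    by (simp add: strongly_uniform_structure_def)
  moreover have "\<forall>i\<in>{1..D}. coord ?f i = 3"
    by (auto simp: coord_def)
  ultimately show ?thesis
    using identity minus plus unfolding supports_strongly_uniform_def by blast
qed

end
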